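(* For any $m\ge 1$, if $W_m$ is the parent of $m+1$ (that is, the vertex to which $m+1$ attaches on arrival), then $$Z_{m+1}+Z_{W_m}>0\quad\text{almost surely.}$$
   Context: The random friend tree process $(T_n)_{n\ge 2}$ is defined as follows. $T_2$ is a single edge joining vertices labelled $1$ and $2$. For $n\ge 2$, given $T_n$ (and the past of the process), $V_n$ is chosen uniformly at random in $\{1,\dots,n\}$, and then $W_n$ is a uniformly random neighbour of $V_n$ in $T_n$; $T_{n+1}$ is obtained from $T_n$ by adding a new vertex labelled $n+1$ joined by an edge to $W_n$. Thus $T_n$ is a tree with vertex set $[n]=\{1,\dots,n\}$. By convention $W_1=1$, so the edge set of $T_n$ is $\{\{m+1,W_m\}:1\le m\le n-1\}$. For $v\in[n]$, $D_n(v)$ is the degree of $v$ in $T_n$, and $Z_v:=\liminf_{n\to\infty} D_n(v)/n$. *)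

theory Defs
  imports "HOL-Probability.Probability"
begin

text \<open>
  Trees on \<open>{1..n}\<close> are coded by the parent sequence: \<open>w m\<close> is the vertex to which \<open>m + 1\<close> attaches.
\<close>

definition tree_edges :: "(nat \<Rightarrow> nat) \<Rightarrow> nat \<Rightarrow> nat set set" where
  "tree_edges w n = {{m + 1, w m} | m. 1 \<le> m \<and> m \<le> n - 1}"

definition neighbours :: "nat set set \<Rightarrow> nat \<Rightarrow> nat set" where
  "neighbours E v = {u. {v, u} \<in> E}"

definition degree :: "nat set set \<Rightarrow> nat \<Rightarrow> nat" where
  "degree E v = card (neighbours E v)"

text \<open>
  The event (as a predicate on outcomes) that the history of the process up to and including
  the formation of \<open>T\<^sub>n\<close> is given by the values \<open>v 2, \<dots>, v (n - 1)\<close> and \<open>w 1, \<dots>, w (n - 1)\<close>.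
  On it, \<open>T\<^sub>n\<close> has edge set \<open>tree_edges w n\<close>.
\<close>

definition past ::
  "(nat \<Rightarrow> 'a \<Rightarrow> nat) \<Rightarrow> (nat \<Rightarrow> 'a \<Rightarrow> nat) \<Rightarrow> nat \<Rightarrow> (nat \<Rightarrow> nat) \<Rightarrow> (nat \<Rightarrow> nat) \<Rightarrow> 'a \<Rightarrow> bool" where
  "past V W n v w \<omega> \<longleftrightarrow>
     (\<forall>k\<in>{2..<n}. V k \<omega> = v k) \<and> (\<forall>k\<in>{1..<n}. W k \<omega> = w k)"

text \<open>
  All variables are discrete, so conditional laws are elementary conditional probabilities
  given histories of positive probability. \<open>V\<close> is only relevant at indices \<open>n \<ge> 2\<close>, \<open>W\<close> at
  indices \<open>n \<ge> 1\<close>.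
\<close>

locale random_friend_tree = prob_space M for M :: "'a measure" +
  fixes V W :: "nat \<Rightarrow> 'a \<Rightarrow> nat"
  assumes V_measurable: "\<And>n. 2 \<le> n \<Longrightarrow> V n \<in> measurable M (count_space UNIV)"
    and W_measurable: "\<And>n. 1 \<le> n \<Longrightarrow> W n \<in> measurable M (count_space UNIV)"
    and W_1: "\<And>\<omega>. \<omega> \<in> space M \<Longrightarrow> W 1 \<omega> = 1"
    and V_uniform: "\<And>n v w x. 2 \<le> n \<Longrightarrow> \<P>(\<omega> in M. past V W n v w \<omega>) > 0 \<Longrightarrow> x \<in> {1..n} \<Longrightarrow>
      \<P>(\<omega> in M. V n \<omega> = x \<bar> past V W n v w \<omega>) = 1 / real n"
    and W_uniform: "\<And>n v w x y. 2 \<le> n \<Longrightarrow> \<P>(\<omega> in M. past V W n v w \<omega> \<and> V n \<omega> = x) > 0 \<Longrightarrow>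
      y \<in> neighbours (tree_edges w n) x \<Longrightarrow>
      \<P>(\<omega> in M. W n \<omega> = y \<bar> past V W n v w \<omega> \<and> V n \<omega> = x) = 1 / real (degree (tree_edges w n) x)"

definition D :: "(nat \<Rightarrow> 'a \<Rightarrow> nat) \<Rightarrow> nat \<Rightarrow> nat \<Rightarrow> 'a \<Rightarrow> nat" where
  "D W n v \<omega> = degree (tree_edges (\<lambda>m. W m \<omega>) n) v"

text \<open>The finitely many \<open>n < v\<close>, for which \<open>v\<close> is not yet present, do not affect the limit inferior.\<close>

definition Z :: "(nat \<Rightarrow> 'a \<Rightarrow> nat) \<Rightarrow> nat \<Rightarrow> 'a \<Rightarrow> ereal" where
  "Z W v \<omega> = liminf (\<lambda>n. ereal (real (D W n v \<omega>) / real n))"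

end

theory Submission
  imports Defs
begin

text \<open>
  Given the tree on \<open>{1..n}\<close>, the next vertex attaches to \<open>y\<close> with probability
  \<open>(\<Sum>x\<sim>y. 1 / deg x) / n\<close>. The proof follows the number \<open>L\<close> of leaf neighbours of a vertex \<open>z\<close>. Every
  leaf neighbour always picks \<open>z\<close> as its friend, so \<open>L\<close> grows by one with probability at least
  \<open>L / n\<close>. A leaf neighbour is lost only when \<open>z\<close> is chosen and picks it, which happens with
  probability \<open>L / (n * deg z) \<le> 1 / n\<close>. Hence, while \<open>L\<close> is large, it behaves like a Polya urn and
  grows linearly in \<open>n\<close>; since the degree is at least \<open>L\<close>, linear growth of \<open>L\<close> gives \<open>Z > 0\<close>.

  Quantitatively, \<open>n / (L - 3)\<close> is a supermartingale while \<open>L \<ge> 6\<close>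
  (\<open>leaf_ratio_supermartingale\<close>). By the maximal inequality, a vertex with \<open>K\<close> leaf neighbours fails to
  keep \<open>L\<close> above a line of positive slope with probability at most \<open>2 / (K - 3)\<close>
  (\<open>prob_leaf_count_fails_linear_le\<close>).

  It remains to see that one of the endpoints of the edge \<open>{u, v}\<close>, where \<open>u = m + 1\<close> and \<open>v = W m\<close>,
  reaches arbitrarily many leaf neighbours almost surely (\<open>AE_edge_leaves_ge\<close>). This is where an edge is
  needed rather than a vertex: an endpoint without leaves is still picked by the other endpoint. The
  potential \<open>edge_potential\<close> is the number of leaves hanging from the edge, with a penalty
  proportional to the smaller endpoint degree if there are none. It has drift at least \<open>1 / (4 * n)\<close>
  (\<open>edge_potential_drift\<close>). The sum of these drifts diverges, so the potential cannot stay bounded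
  above. Letting \<open>K\<close> tend to infinity finishes the proof. Each endpoint is followed separately, because
  \<open>Z u + Z v\<close> is a sum of two limits inferior, and it does not suffice that the two counts together
  grow linearly.
\<close>

section \<open>The tree and one-step attachment probabilities\<close>

definition recursive_tree :: "(nat \<Rightarrow> nat) \<Rightarrow> nat \<Rightarrow> bool" where
  "recursive_tree w n \<longleftrightarrow> (\<forall>k\<in>{1..<n}. w k \<in> {1..k})"

abbreviation nbrs :: "(nat \<Rightarrow> nat) \<Rightarrow> nat \<Rightarrow> nat \<Rightarrow> nat set" where
  "nbrs w n \<equiv> neighbours (tree_edges w n)"

abbreviation deg :: "(nat \<Rightarrow> nat) \<Rightarrow> nat \<Rightarrow> nat \<Rightarrow> nat" where
  "deg w n \<equiv> degree (tree_edges w n)"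

definition leaves :: "(nat \<Rightarrow> nat) \<Rightarrow> nat \<Rightarrow> nat \<Rightarrow> nat set" where
  "leaves w n z = {x \<in> nbrs w n z. deg w n x = 1}"

text \<open>
  The conditional probability, given the tree, that the next vertex attaches to \<open>y\<close>: each neighbour
  \<open>x\<close> of \<open>y\<close> is the chosen vertex with probability \<open>1 / n\<close> and then picks \<open>y\<close> with probability
  \<open>1 / deg x\<close>.
\<close>

definition attach_prob :: "(nat \<Rightarrow> nat) \<Rightarrow> nat \<Rightarrow> nat \<Rightarrow> real" where
  "attach_prob w n y = (\<Sum>x\<in>nbrs w n y. 1 / real (deg w n x)) / real n"

lemma mem_nbrs_iff:
  "x \<in> nbrs w n z \<longleftrightarrow>
     (\<exists>k\<in>{1..<n}. (z = Suc k \<and> x = w k) \<or> (x = Suc k \<and> z = w k))"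
proof -
  have "x \<in> nbrs w n z \<longleftrightarrow> (\<exists>k. {z, x} = {k + 1, w k} \<and> 1 \<le> k \<and> k \<le> n - 1)"
    unfolding neighbours_def tree_edges_def by simp
  also have "\<dots> \<longleftrightarrow> (\<exists>k\<in>{1..<n}. {z, x} = {k + 1, w k})"
    by (rule iff_exI[THEN trans[OF _ Bex_def[symmetric]]]) auto
  finally show ?thesis unfolding doubleton_eq_iff by auto
qed

lemma nbrs_sym: "x \<in> nbrs w n z \<longleftrightarrow> z \<in> nbrs w n x"
  unfolding mem_nbrs_iff by blast

lemma tree_edges_cong:
  assumes "\<And>k. k \<in> {1..<n} \<Longrightarrow> w k = w' k"
  shows "tree_edges w n = tree_edges w' n"
proof -
  have "w k = w' k" if "1 \<le> k" "k \<le> n - 1" for k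
    using assms[of k] that by auto
  then show ?thesis unfolding tree_edges_def by auto
qed

lemma leaves_cong:
  assumes "\<And>k. k \<in> {1..<n} \<Longrightarrow> w k = w' k"
  shows "leaves w n z = leaves w' n z"
proof -
  have "tree_edges w n = tree_edges w' n" using assms by (rule tree_edges_cong)
  then show ?thesis by (simp add: leaves_def)
qed

lemma finite_nbrs [simp]: "finite (nbrs w n z)"
  by (rule finite_subset[of _ "Suc ` {1..<n} \<union> w ` {1..<n}"]) (auto simp: mem_nbrs_iff)

lemma finite_leaves [simp]: "finite (leaves w n z)"
  unfolding leaves_def by simp

lemma card_leaves_le: "card (leaves w n z) \<le> deg w n z"
  unfolding degree_def leaves_def by (rule card_mono) auto

context
  fixes w :: "nat \<Rightarrow> nat" and n :: nat
  assumes rt: "recursive_tree w n"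
begin

lemma nbrs_subset: "nbrs w n z \<subseteq> {1..n}"
  using rt unfolding recursive_tree_def by (fastforce simp: mem_nbrs_iff)

lemma nbrs_irrefl: "z \<notin> nbrs w n z"
  using rt unfolding recursive_tree_def by (fastforce simp: mem_nbrs_iff)

lemma nbrs_nonempty:
  assumes "2 \<le> n" "z \<in> {1..n}"
  shows "nbrs w n z \<noteq> {}"
proof (cases "z = 1")
  case True
  have "w 1 = 1" using rt assms(1) bspec[of "{1..<n}" "\<lambda>k. w k \<in> {1..k}" 1]
    unfolding recursive_tree_def by simp
  then have "2 \<in> nbrs w n z" unfolding mem_nbrs_iff using assms True
    by (intro bexI[of _ 1]) auto
  then show ?thesis by blast
next
  case False
  then have "w (z - 1) \<in> nbrs w n z" unfolding mem_nbrs_iff using assms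
    by (intro bexI[of _ "z - 1"]) auto
  then show ?thesis by blast
qed

lemma degree_pos:
  assumes "2 \<le> n" "z \<in> {1..n}"
  shows "0 < deg w n z"
  using nbrs_nonempty[OF assms] by (simp add: degree_def card_gt_0_iff)

lemma leaf_nbrs:
  assumes "x \<in> leaves w n z"
  shows "nbrs w n x = {z}"
proof -
  have "z \<in> nbrs w n x" "card (nbrs w n x) = 1"
    using assms nbrs_sym by (auto simp: leaves_def degree_def)
  then show ?thesis by (metis card_1_singletonE singletonD)
qed

lemma nbrs_upd:
  assumes "y \<in> {1..n}"
  shows "nbrs (w(n := y)) (Suc n) x =
     (if x = Suc n then {y} else if x = y then insert (Suc n) (nbrs w n x) else nbrs w n x)"
proof -
  have n1: "1 \<le> n" using assms by simp
  have S: "{1..<Suc n} = insert n {1..<n}" using n1 by auto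
  have "z \<in> nbrs (w(n := y)) (Suc n) x \<longleftrightarrow>
     z \<in> nbrs w n x \<or> (x = Suc n \<and> z = y) \<or> (z = Suc n \<and> x = y)" for z
    unfolding mem_nbrs_iff S by auto
  moreover have "z \<notin> nbrs w n (Suc n)" for z
    using nbrs_subset[of z] nbrs_sym[of z w n "Suc n"] by auto
  ultimately show ?thesis using assms by auto
qed

lemma degree_upd:
  assumes "y \<in> {1..n}"
  shows "deg (w(n := y)) (Suc n) x =
     (if x = Suc n then 1 else if x = y then Suc (deg w n x) else deg w n x)"
  using nbrs_subset[of y] by (auto simp: degree_def nbrs_upd[OF assms] card_insert_if)

text \<open>
  The only ways to change the leaf neighbours of \<open>z\<close> are to attach to \<open>z\<close> itself, since the new
  vertex is a leaf, and to attach to one of the leaf neighbours, which then stops being a leaf.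
\<close>

lemma leaves_upd:
  assumes "y \<in> {1..n}" "2 \<le> n" "z \<in> {1..n}"
  shows "leaves (w(n := y)) (Suc n) z =
     (if y = z then insert (Suc n) (leaves w n z) else leaves w n z - {y})"
proof -
  have "z \<noteq> Suc n" using assms by simp
  have "0 < deg w n y" using degree_pos assms by blast
  then show ?thesis
    using nbrs_irrefl[of z] nbrs_subset[of z] \<open>z \<noteq> Suc n\<close> assms(1)
    unfolding leaves_def nbrs_upd[OF assms(1)] degree_upd[OF assms(1)]
    by (auto split: if_splits)
qed

lemma attach_prob_nonneg: "0 \<le> attach_prob w n y"
  unfolding attach_prob_def by (simp add: sum_nonneg)

lemma sum_attach_prob_eq:
  "(\<Sum>y\<in>{1..n}. attach_prob w n y * f y) =
   (\<Sum>x\<in>{1..n}. \<Sum>y\<in>nbrs w n x. f y / (real n * real (deg w n x)))"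
proof -
  have "(\<Sum>y\<in>{1..n}. attach_prob w n y * f y) =
        (\<Sum>y\<in>{1..n}. \<Sum>x\<in>nbrs w n y. f y / (real n * real (deg w n x)))"
    unfolding attach_prob_def sum_divide_distrib sum_distrib_right
    by (simp add: mult.commute)
  also have "\<dots> = (\<Sum>y\<in>{1..n}. \<Sum>x | x \<in> {1..n} \<and> y \<in> nbrs w n x. f y / (real n * real (deg w n x)))"
    using nbrs_subset nbrs_sym by (intro sum.cong refl) blast
  also have "\<dots> = (\<Sum>x\<in>{1..n}. \<Sum>y | y \<in> {1..n} \<and> y \<in> nbrs w n x. f y / (real n * real (deg w n x)))"
    by (rule sum.swap_restrict) auto
  also have "\<dots> = (\<Sum>x\<in>{1..n}. \<Sum>y\<in>nbrs w n x. f y / (real n * real (deg w n x)))"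
    using nbrs_subset by (intro sum.cong refl) blast
  finally show ?thesis .
qed

lemma sum_attach_prob:
  assumes "2 \<le> n"
  shows "(\<Sum>y\<in>{1..n}. attach_prob w n y) = 1"
proof -
  have "(\<Sum>y\<in>nbrs w n x. 1 / (real n * real (deg w n x))) = 1 / real n" if "x \<in> {1..n}" for x
    using nbrs_nonempty[OF assms that] by (simp add: degree_def)
  then show ?thesis
    using sum_attach_prob_eq[of "\<lambda>_. 1"] assms by simp
qed

text \<open>
  Every drift computed below reduces through this formula to the few vertices at which an attachment
  changes the quantity in question.
\<close>

lemma sum_attach_prob_local:
  assumes "2 \<le> n" "S \<subseteq> {1..n}" "\<And>y. y \<in> {1..n} - S \<Longrightarrow> f y = c"
  shows "(\<Sum>y\<in>{1..n}. attach_prob w n y * f y) = c + (\<Sum>y\<in>S. attach_prob w n y * (f y - c))"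
proof -
  have "(\<Sum>y\<in>{1..n}. attach_prob w n y * f y) - c =
        (\<Sum>y\<in>{1..n}. attach_prob w n y * (f y - c))"
    using sum_attach_prob[OF assms(1)]
    by (simp add: right_diff_distrib sum_subtractf flip: sum_distrib_right)
  also have "\<dots> = (\<Sum>y\<in>S. attach_prob w n y * (f y - c))"
    using assms by (intro sum.mono_neutral_right) auto
  finally show ?thesis by simp
qed

text \<open>
  A leaf is reached only through its unique neighbour. So the leaf neighbours of \<open>z\<close> are hit with
  total probability at most \<open>1 / n\<close>, however many there are, whereas each of them
  contributes \<open>1 / n\<close> to the probability of attaching to \<open>z\<close>.
\<close>

lemma attach_prob_leaf:
  assumes "x \<in> leaves w n z"
  shows "attach_prob w n x = 1 / (real n * real (deg w n z))"
  unfolding attach_prob_def leaf_nbrs[OF assms] by simp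

lemma attach_prob_ge:
  assumes "S \<subseteq> nbrs w n z"
  shows "(\<Sum>x\<in>S. 1 / real (deg w n x)) / real n \<le> attach_prob w n z"
  unfolding attach_prob_def using assms
  by (intro divide_right_mono sum_mono2) auto

end

section \<open>Averages over finite histories\<close>

text \<open>
  \<open>F\<close> is a function of the tree on \<open>{1..n}\<close> only; this plays the part of measurability with respect
  to the past.
\<close>

definition determined_before :: "nat \<Rightarrow> ((nat \<Rightarrow> nat) \<Rightarrow> 'b) \<Rightarrow> bool" where
  "determined_before n F \<longleftrightarrow> (\<forall>w w'. (\<forall>k\<in>{1..<n}. w k = w' k) \<longrightarrow> F w = F w')"

text \<open>
  All values that \<open>(V 2, \<dots>, V (n - 1))\<close> and \<open>(W 1, \<dots>, W (n - 1))\<close> can take, up to null events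
  (\<open>mean_one\<close>).
\<close>

definition histories :: "nat \<Rightarrow> ((nat \<Rightarrow> nat) \<times> (nat \<Rightarrow> nat)) set" where
  "histories n = (\<Pi>\<^sub>E k\<in>{2..<n}. {1..k}) \<times> (\<Pi>\<^sub>E k\<in>{1..<n}. {1..k})"

lemma finite_histories [simp]: "finite (histories n)"
  unfolding histories_def by (auto intro: finite_PiE)

lemma histories_recursive: "h \<in> histories n \<Longrightarrow> recursive_tree (snd h) n"
  unfolding histories_def recursive_tree_def by (auto simp: PiE_iff)

lemma sum_PiE_insert:
  assumes "n \<notin> I"
  shows "(\<Sum>g\<in>Pi\<^sub>E (insert n I) T. f g) = (\<Sum>g\<in>Pi\<^sub>E I T. \<Sum>y\<in>T n. f (g(n := y)))"
proof -
  have "(\<Sum>g\<in>Pi\<^sub>E (insert n I) T. f g) = (\<Sum>(y, g)\<in>T n \<times> Pi\<^sub>E I T. f (g(n := y)))"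
    unfolding PiE_insert_eq sum.reindex[OF inj_combinator[OF assms]]
    by (simp add: split_def comp_def)
  also have "\<dots> = (\<Sum>y\<in>T n. \<Sum>g\<in>Pi\<^sub>E I T. f (g(n := y)))"
    by (simp add: sum.cartesian_product)
  finally show ?thesis by (simp add: sum.swap[of _ _ "T n"])
qed

lemma sum_histories_Suc:
  assumes "2 \<le> n"
  shows "(\<Sum>h\<in>histories (Suc n). f h) =
    (\<Sum>h\<in>histories n. \<Sum>x\<in>{1..n}. \<Sum>y\<in>{1..n}. f ((fst h)(n := x), (snd h)(n := y)))"
proof -
  have S: "{2..<Suc n} = insert n {2..<n}" "{1..<Suc n} = insert n {1..<n}"
    using assms by auto
  let ?A = "\<Pi>\<^sub>E k\<in>{2..<n}. {1..k}" and ?B = "\<Pi>\<^sub>E k\<in>{1..<n}. {1..k}"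
  have "(\<Sum>h\<in>histories (Suc n). f h) =
    (\<Sum>v\<in>?A. \<Sum>x\<in>{1..n}. \<Sum>w\<in>?B. \<Sum>y\<in>{1..n}. f (v(n := x), w(n := y)))"
    unfolding histories_def S sum.cartesian_product' by (simp add: sum_PiE_insert)
  also have "\<dots> = (\<Sum>v\<in>?A. \<Sum>w\<in>?B. \<Sum>x\<in>{1..n}. \<Sum>y\<in>{1..n}. f (v(n := x), w(n := y)))"
    by (intro sum.cong refl sum.swap)
  finally show ?thesis unfolding histories_def sum.cartesian_product' by simp
qed

context random_friend_tree
begin

lemma past_upd:
  assumes "2 \<le> n"
  shows "past V W (Suc n) (v(n := x)) (w(n := y)) \<omega> \<longleftrightarrow>
    past V W n v w \<omega> \<and> V n \<omega> = x \<and> W n \<omega> = y"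
proof -
  have "{2..<Suc n} = insert n {2..<n}" "{1..<Suc n} = insert n {1..<n}"
    using assms by auto
  then show ?thesis unfolding past_def by auto
qed

lemma V_event: "2 \<le> n \<Longrightarrow> Measurable.pred M (\<lambda>\<omega>. V n \<omega> = x)"
  using V_measurable[of n] by measurable

lemma W_event: "1 \<le> n \<Longrightarrow> Measurable.pred M (\<lambda>\<omega>. W n \<omega> = x)"
  using W_measurable[of n] by measurable

lemma past_event: "Measurable.pred M (past V W n v w)"
  unfolding past_def[abs_def]
  by (intro pred_intros_logic pred_intros_finite V_event W_event) auto

lemma sets_past: "{\<omega> \<in> space M. past V W n v w \<omega>} \<in> events"
  using past_event[of n v w] by (simp add: pred_def)

text \<open>
  The hypotheses on the conditional laws give the factor for neighbours \<open>y\<close> of \<open>x\<close>. For other \<open>y\<close>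
  the probability vanishes because the neighbours already exhaust the conditional law of \<open>W n\<close>.
\<close>

lemma prob_past_upd:
  assumes n: "2 \<le> n" and w: "recursive_tree w n" and x: "x \<in> {1..n}"
  shows "\<P>(\<omega> in M. past V W (Suc n) (v(n := x)) (w(n := y)) \<omega>) =
    \<P>(\<omega> in M. past V W n v w \<omega>) *
    (if y \<in> nbrs w n x then 1 / (real n * real (deg w n x)) else 0)"
proof -
  let ?p = "\<P>(\<omega> in M. past V W n v w \<omega>)"
  let ?px = "\<P>(\<omega> in M. past V W n v w \<omega> \<and> V n \<omega> = x)"
  let ?E = "\<lambda>y. {\<omega> \<in> space M. (past V W n v w \<omega> \<and> V n \<omega> = x) \<and> W n \<omega> = y}"
  have evx: "{\<omega> \<in> space M. past V W n v w \<omega> \<and> V n \<omega> = x} \<in> events"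
    using past_event[of n v w] V_event[OF n, of x] by measurable
  have "Measurable.pred M (\<lambda>\<omega>. W n \<omega> = y)" for y using W_event n by simp
  then have evE: "?E y \<in> events" for y
    using past_event[of n v w] V_event[OF n, of x] by measurable
  have eq: "\<P>(\<omega> in M. past V W (Suc n) (v(n := x)) (w(n := y)) \<omega>) = prob (?E y)"
    unfolding past_upd[OF n] by (simp add: conj_assoc)
  have le: "prob (?E y) \<le> ?p"
    by (rule finite_measure_mono[OF _ sets_past]) auto
  show ?thesis
  proof (cases "?p = 0")
    case True
    then show ?thesis using le eq by (simp add: measure_le_0_iff)
  next
    case False
    then have p: "?p > 0" by (simp add: zero_less_measure_iff)
    have "\<P>(\<omega> in M. V n \<omega> = x \<and> past V W n v w \<omega>) / ?p = 1 / real n"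
      using V_uniform[OF n p x] by (simp add: cond_prob_def)
    then have px: "?px = ?p / real n" using p by (simp add: conj_commute field_simps)
    then have px0: "?px > 0" using p n by simp
    have W: "prob (?E y) = ?px / real (deg w n x)" if "y \<in> nbrs w n x" for y
    proof -
      have "\<P>(\<omega> in M. W n \<omega> = y \<and> past V W n v w \<omega> \<and> V n \<omega> = x) / ?px = 1 / real (deg w n x)"
        using W_uniform[OF n px0 that] by (simp add: cond_prob_def)
      then show ?thesis using px0 by (simp add: conj_ac field_simps)
    qed
    show ?thesis
    proof (cases "y \<in> nbrs w n x")
      case True
      then show ?thesis unfolding eq W[OF True] px by (simp add: field_simps)
    next
      case y: False
      have fin: "finite (nbrs w n x)" using finite_nbrs .
      have "prob (\<Union>y'\<in>insert y (nbrs w n x). ?E y') = (\<Sum>y'\<in>insert y (nbrs w n x). prob (?E y'))"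
        using evE fin by (intro finite_measure_finite_Union) (auto simp: disjoint_family_on_def)
      also have "\<dots> = prob (?E y) + (\<Sum>y'\<in>nbrs w n x. ?px / real (deg w n x))"
        using y fin W by simp
      also have "(\<Sum>y'\<in>nbrs w n x. ?px / real (deg w n x)) = ?px"
        using nbrs_nonempty[OF w n x] fin by (simp add: degree_def)
      finally have "prob (?E y) + ?px = prob (\<Union>y'\<in>insert y (nbrs w n x). ?E y')" by simp
      also have "\<dots> \<le> ?px" by (rule finite_measure_mono[OF _ evx]) auto
      finally have "prob (?E y) = 0" by (simp add: measure_le_0_iff)
      then show ?thesis using eq y by simp
    qed
  qed
qed

text \<open>
  The expectation of \<open>F (W 1, W 2, \<dots>)\<close> for \<open>F\<close> determined before \<open>n\<close>, written as a finite sum over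
  histories. In this form conditioning on the past is a rearrangement of finite sums (\<open>mean_Suc\<close>).
\<close>

definition mean :: "nat \<Rightarrow> ((nat \<Rightarrow> nat) \<Rightarrow> real) \<Rightarrow> real" where
  "mean n F = (\<Sum>h\<in>histories n. \<P>(\<omega> in M. past V W n (fst h) (snd h) \<omega>) * F (snd h))"

lemma mean_mono:
  assumes "\<And>w. recursive_tree w n \<Longrightarrow> F w \<le> G w"
  shows "mean n F \<le> mean n G"
  unfolding mean_def using assms histories_recursive
  by (intro sum_mono mult_left_mono) auto

lemma mean_add: "mean n (\<lambda>w. F w + G w) = mean n F + mean n G"
  unfolding mean_def by (simp add: distrib_left sum.distrib)

lemma mean_cmult: "mean n (\<lambda>w. c * F w) = c * mean n F"
  unfolding mean_def by (simp add: sum_distrib_left mult_ac)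

lemma mean_Suc:
  assumes n: "2 \<le> n"
  shows "mean (Suc n) F = mean n (\<lambda>w. \<Sum>y\<in>{1..n}. attach_prob w n y * F (w(n := y)))"
proof -
  have "(\<Sum>x\<in>{1..n}. \<Sum>y\<in>{1..n}.
        \<P>(\<omega> in M. past V W (Suc n) ((fst h)(n := x)) ((snd h)(n := y)) \<omega>) * F ((snd h)(n := y))) =
      \<P>(\<omega> in M. past V W n (fst h) (snd h) \<omega>) *
        (\<Sum>y\<in>{1..n}. attach_prob (snd h) n y * F ((snd h)(n := y)))"
    if "h \<in> histories n" for h
  proof -
    let ?p = "\<P>(\<omega> in M. past V W n (fst h) (snd h) \<omega>)"
    have w: "recursive_tree (snd h) n" using histories_recursive that .
    have "(\<Sum>y\<in>{1..n}. \<P>(\<omega> in M. past V W (Suc n) ((fst h)(n := x)) ((snd h)(n := y)) \<omega>) *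
         F ((snd h)(n := y))) =
       ?p * (\<Sum>y\<in>nbrs (snd h) n x. F ((snd h)(n := y)) / (real n * real (deg (snd h) n x)))"
      if x: "x \<in> {1..n}" for x
      unfolding prob_past_upd[OF n w x] sum_distrib_left using nbrs_subset[OF w]
      by (intro sum.mono_neutral_cong_right) auto
    then show ?thesis
      unfolding sum_attach_prob_eq[OF w] by (simp add: sum_distrib_left)
  qed
  then show ?thesis
    unfolding mean_def sum_histories_Suc[OF n] by simp
qed

text \<open>
  The histories carry full probability: one-step transitions stay inside \<open>histories\<close>,
  and their probabilities sum to one.
\<close>

lemma mean_one:
  assumes "2 \<le> n"
  shows "mean n (\<lambda>_. 1) = 1"
  using assms
proof (induction n rule: dec_induct)
  case base
  have "(\<Sum>w\<in>(\<Pi>\<^sub>E k\<in>{1..<2}. {1..k}). f w) = f ((\<lambda>_. undefined)(1 := 1))"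
    for f :: "(nat \<Rightarrow> nat) \<Rightarrow> real"
  proof -
    have "{1..<2} = insert (1::nat) {}" by auto
    then show ?thesis using sum_PiE_insert[of 1 "{}" f "\<lambda>k. {1..k}"] by (simp add: fun_upd_def)
  qed
  then have "mean 2 (\<lambda>_. 1) = \<P>(\<omega> in M. past V W 2 (\<lambda>_. undefined) ((\<lambda>_. undefined)(1 := 1)) \<omega>)"
    unfolding mean_def histories_def sum.cartesian_product' by (simp add: fun_upd_def)
  also have "{\<omega> \<in> space M. past V W 2 (\<lambda>_. undefined) ((\<lambda>_. undefined)(1 := 1)) \<omega>} = space M"
  proof -
    have "{1..<2} = {1::nat}" by auto
    then show ?thesis using W_1 unfolding past_def by auto
  qed
  finally show ?case by (simp add: prob_space)
next
  case (step n)
  have "mean (Suc n) (\<lambda>_. 1) = mean n (\<lambda>w. \<Sum>y\<in>{1..n}. attach_prob w n y * 1)"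
    using mean_Suc step by simp
  also have "\<dots> = mean n (\<lambda>_. 1)"
    using sum_attach_prob histories_recursive step by (simp add: mean_def)
  finally show ?case using step by simp
qed

lemma mean_const: "2 \<le> n \<Longrightarrow> mean n (\<lambda>_. c) = c"
  using mean_cmult[of n c "\<lambda>_. 1"] mean_one by simp

lemma determined_event:
  assumes "determined_before n Q"
  shows "Measurable.pred M (\<lambda>\<omega>. Q (\<lambda>k. W k \<omega>))"
proof -
  have "Q (\<lambda>k. W k \<omega>) \<longleftrightarrow> (\<exists>l :: nat list. Q (\<lambda>k. l ! k) \<and> (\<forall>k\<in>{1..<n}. W k \<omega> = l ! k))" for \<omega>
  proof
    assume "Q (\<lambda>k. W k \<omega>)"
    moreover have "Q (\<lambda>k. W k \<omega>) = Q (\<lambda>k. map (\<lambda>k. W k \<omega>) [0..<n] ! k)"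
      using assms unfolding determined_before_def by (elim allE impE) auto
    ultimately show "\<exists>l. Q (\<lambda>k. l ! k) \<and> (\<forall>k\<in>{1..<n}. W k \<omega> = l ! k)"
      by (intro exI[of _ "map (\<lambda>k. W k \<omega>) [0..<n]"]) auto
  next
    assume "\<exists>l. Q (\<lambda>k. l ! k) \<and> (\<forall>k\<in>{1..<n}. W k \<omega> = l ! k)"
    then show "Q (\<lambda>k. W k \<omega>)" using assms unfolding determined_before_def by metis
  qed
  moreover have "Measurable.pred M (\<lambda>\<omega>. \<forall>k\<in>{1..<n}. W k \<omega> = l ! k)" for l
    by (intro pred_intros_finite W_event) auto
  ultimately show ?thesis by simp
qed

lemma prob_eq_mean:
  assumes n: "2 \<le> n" and Q: "determined_before n Q"
  shows "\<P>(\<omega> in M. Q (\<lambda>k. W k \<omega>)) = mean n (\<lambda>w. of_bool (Q w))"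
proof -
  let ?P = "\<lambda>h. past V W n (fst h) (snd h)"
  have uniq: "h = h'" if "h \<in> histories n" "h' \<in> histories n" "?P h \<omega>" "?P h' \<omega>" for h h' \<omega>
  proof -
    have "fst h = fst h'"
      using that unfolding histories_def past_def
      by (intro PiE_ext[of "fst h" "{2..<n}" "\<lambda>k. {1..k}"]) (auto simp: mem_Times_iff)
    moreover have "snd h = snd h'"
      using that unfolding histories_def past_def
      by (intro PiE_ext[of "snd h" "{1..<n}" "\<lambda>k. {1..k}"]) (auto simp: mem_Times_iff)
    ultimately show ?thesis by (simp add: prod_eq_iff)
  qed
  have ev: "{\<omega> \<in> space M. \<exists>h\<in>histories n. ?P h \<omega>} \<in> events"
    using past_event by (intro predE pred_intros_finite) auto
  have "\<P>(\<omega> in M. \<exists>h\<in>histories n. ?P h \<omega>) = (\<Sum>h\<in>histories n. \<P>(\<omega> in M. ?P h \<omega>))"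
    by (rule prob_sum) (use ev sets_past uniq in auto)
  also have "\<dots> = 1" using mean_one[OF n] by (simp add: mean_def)
  finally have "AE \<omega> in M. \<exists>h\<in>histories n. ?P h \<omega>"
    using prob_Collect_eq_1[OF ev] by simp
  then have ae: "AE \<omega> in M. \<exists>!h. h \<in> histories n \<and> ?P h \<omega>"
    by (rule AE_mp) (use uniq in auto)
  have "\<P>(\<omega> in M. Q (\<lambda>k. W k \<omega>)) = (\<Sum>h\<in>histories n. \<P>(\<omega> in M. ?P h \<omega> \<and> Q (\<lambda>k. W k \<omega>)))"
  proof (rule prob_sum)
    show "{\<omega> \<in> space M. Q (\<lambda>k. W k \<omega>)} \<in> events"
      using determined_event[OF Q] by (simp add: pred_def)
    show "{\<omega> \<in> space M. ?P h \<omega> \<and> Q (\<lambda>k. W k \<omega>)} \<in> events" for h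
      using determined_event[OF Q] past_event[of n "fst h" "snd h"] by measurable
    show "AE \<omega> in M. (\<forall>h\<in>histories n. ?P h \<omega> \<and> Q (\<lambda>k. W k \<omega>) \<longrightarrow> Q (\<lambda>k. W k \<omega>)) \<and>
        (Q (\<lambda>k. W k \<omega>) \<longrightarrow> (\<exists>!h. h \<in> histories n \<and> ?P h \<omega> \<and> Q (\<lambda>k. W k \<omega>)))"
      using ae by (rule AE_mp) auto
  qed simp
  also have "\<dots> = mean n (\<lambda>w. of_bool (Q w))"
    unfolding mean_def
  proof (intro sum.cong refl)
    fix h
    have "Q (\<lambda>k. W k \<omega>) = Q (snd h)" if "?P h \<omega>" for \<omega>
      using that Q[unfolded determined_before_def, rule_format, of "\<lambda>k. W k \<omega>" "snd h"]
      unfolding past_def by blast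
    then have "{\<omega> \<in> space M. ?P h \<omega> \<and> Q (\<lambda>k. W k \<omega>)} =
        (if Q (snd h) then {\<omega> \<in> space M. ?P h \<omega>} else {})" by (auto split: if_splits)
    then show "\<P>(\<omega> in M. ?P h \<omega> \<and> Q (\<lambda>k. W k \<omega>)) = \<P>(\<omega> in M. ?P h \<omega>) * of_bool (Q (snd h))"
      by (cases "Q (snd h)") (simp_all only: if_True if_False of_bool_eq mult_1_right mult_zero_right measure_empty)
  qed
  finally show ?thesis .
qed

end

section \<open>Drift of the leaf counts\<close>

text \<open>
  Leaves hanging from the edge \<open>{u, v}\<close>. The opposite endpoint is discarded, for it may be a leaf
  itself, and attaching to it must count as a gain.
\<close>

definition edge_leaves :: "(nat \<Rightarrow> nat) \<Rightarrow> nat \<Rightarrow> nat \<Rightarrow> nat \<Rightarrow> nat" where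
  "edge_leaves w n u v = card (leaves w n u - {v}) + card (leaves w n v - {u})"

text \<open>
  When no leaf hangs from the edge, one of the endpoints is hit with probability at least
  \<open>1 / (n * min (deg u) (deg v))\<close>, through the other endpoint. The potential charges such a state an
  amount proportional to \<open>min (deg u) (deg v)\<close>, so that leaving it makes up for the long wait.
  Entering such a state is affordable: it requires hitting the last leaf, at \<open>u\<close> say, which has
  probability only \<open>1 / (n * deg u)\<close>.
\<close>

definition edge_potential :: "(nat \<Rightarrow> nat) \<Rightarrow> nat \<Rightarrow> nat \<Rightarrow> nat \<Rightarrow> real" where
  "edge_potential w n u v = real (edge_leaves w n u v) -
     (if edge_leaves w n u v = 0 then real (min (deg w n u) (deg w n v)) / 4 else 0)"

context
  fixes w :: "nat \<Rightarrow> nat" and n u v :: nat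
  assumes rt: "recursive_tree w n" and n2: "2 \<le> n" and uv: "v \<in> nbrs w n u"
begin

lemma edge_ends: "u \<in> {1..n}" "v \<in> {1..n}" "u \<noteq> v"
  using nbrs_subset[OF rt] nbrs_irrefl[OF rt] uv nbrs_sym by blast+

lemma card_leaves_upd_minus:
  assumes "y \<in> {1..n}"
  shows "card (leaves (w(n := y)) (Suc n) u - {v}) =
    (if y = u then Suc (card (leaves w n u - {v}))
     else if y \<in> leaves w n u - {v} then card (leaves w n u - {v}) - 1
     else card (leaves w n u - {v}))"
proof -
  have "Suc n \<notin> leaves w n u" "u \<notin> leaves w n u"
    using nbrs_subset[OF rt, of u] nbrs_irrefl[OF rt, of u] by (auto simp: leaves_def)
  moreover have "v \<noteq> Suc n" using edge_ends by simp
  ultimately have "leaves (w(n := y)) (Suc n) u - {v} =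
     (if y = u then insert (Suc n) (leaves w n u - {v}) else (leaves w n u - {v}) - {y})"
    unfolding leaves_upd[OF rt assms n2 edge_ends(1)] by auto
  then show ?thesis
    using \<open>Suc n \<notin> leaves w n u\<close> finite_leaves by (simp add: card_Diff_singleton)
qed

lemma card_leaves_minus_less: "card (leaves w n u - {v}) < deg w n u"
proof -
  have "card (insert v (leaves w n u - {v})) \<le> deg w n u"
    unfolding degree_def using uv finite_nbrs by (intro card_mono) (auto simp: leaves_def)
  then show ?thesis using finite_leaves by (simp del: insert_Diff_single)
qed

lemma attach_prob_edge_end:
  "(real (card (leaves w n u - {v})) + 1 / real (deg w n v)) / real n \<le> attach_prob w n u"
proof -
  have "(\<Sum>x\<in>insert v (leaves w n u - {v}). 1 / real (deg w n x)) / real n \<le> attach_prob w n u"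
    by (rule attach_prob_ge[OF rt]) (use uv in \<open>auto simp: leaves_def\<close>)
  moreover have "(\<Sum>x\<in>leaves w n u - {v}. 1 / real (deg w n x)) = real (card (leaves w n u - {v}))"
    by (simp add: leaves_def)
  ultimately show ?thesis using finite_leaves by (simp add: add.commute del: insert_Diff_single)
qed

end

text \<open>
  With \<open>a\<close> and \<open>b\<close> leaves at \<open>u\<close> and \<open>v\<close>, attaching to \<open>u\<close> has probability at least \<open>a / n\<close> and gains
  one. Hitting one of the \<open>a\<close> leaves has probability \<open>a / (n * deg u)\<close> and loses at most
  \<open>1 + deg u / 4\<close>. If \<open>a > 0\<close> then \<open>deg u \<ge> 2\<close>, as \<open>v\<close> is a further neighbour, so \<open>u\<close>
  contributes at least \<open>a * (1 - 1/2 - 1/4) / n\<close> to the drift; likewise for \<open>v\<close>. If \<open>a = b = 0\<close>, the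
  charge alone provides the drift.
\<close>

lemma edge_potential_drift:
  assumes rt: "recursive_tree w n" and n2: "2 \<le> n" and uv: "v \<in> nbrs w n u"
  shows "edge_potential w n u v + 1 / (4 * real n) \<le>
    (\<Sum>y\<in>{1..n}. attach_prob w n y * edge_potential (w(n := y)) (Suc n) u v)"
proof -
  have vu: "u \<in> nbrs w n v" using uv nbrs_sym by blast
  note ends = edge_ends[OF rt n2 uv]
  let ?A = "leaves w n u - {v}" and ?B = "leaves w n v - {u}"
  let ?f = "\<lambda>y. edge_potential (w(n := y)) (Suc n) u v" and ?c = "edge_potential w n u v"
  define a b du dv where "a = card ?A" and "b = card ?B"
    and "du = deg w n u" and "dv = deg w n v"
  have cA: "card (leaves (w(n := y)) (Suc n) u - {v}) =
      (if y = u then Suc a else if y \<in> ?A then a - 1 else a)"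
    and cB: "card (leaves (w(n := y)) (Suc n) v - {u}) =
      (if y = v then Suc b else if y \<in> ?B then b - 1 else b)" if "y \<in> {1..n}" for y
    using card_leaves_upd_minus[OF rt n2 uv that] card_leaves_upd_minus[OF rt n2 vu that]
    by (simp_all add: a_def b_def)
  have X: "edge_leaves w n u v = a + b" by (simp add: edge_leaves_def a_def b_def)
  have notA: "u \<notin> ?A" "v \<notin> ?A" and notB: "u \<notin> ?B" "v \<notin> ?B"
    using nbrs_irrefl[OF rt] by (auto simp: leaves_def)
  have disj: "?A \<inter> ?B = {}"
    using leaf_nbrs[OF rt] ends(3) by (metis Diff_iff Int_emptyI singleton_inject)
  have fin: "finite ?A" "finite ?B" using finite_leaves by auto
  have sub: "?A \<subseteq> {1..n}" "?B \<subseteq> {1..n}" using nbrs_subset[OF rt] by (auto simp: leaves_def)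
  have dpos: "0 < du" "0 < dv" using degree_pos[OF rt n2] ends by (auto simp: du_def dv_def)
  have ad: "a < du" and bd: "b < dv"
    using card_leaves_minus_less[OF rt n2 uv] card_leaves_minus_less[OF rt n2 vu]
    by (auto simp: a_def b_def du_def dv_def)
  have pu: "(real a + 1 / real dv) / real n \<le> attach_prob w n u"
    and pv: "(real b + 1 / real du) / real n \<le> attach_prob w n v"
    using attach_prob_edge_end[OF rt n2 uv] attach_prob_edge_end[OF rt n2 vu]
    by (auto simp: a_def b_def du_def dv_def)
  have fu: "?f u = a + b + 1" and fv: "?f v = a + b + 1"
    using cA[of u] cB[of u] cA[of v] cB[of v] ends notA notB
    by (auto simp: edge_potential_def edge_leaves_def)
  have c: "?c = (if a + b = 0 then - (real (min du dv) / 4) else a + b)"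
    unfolding edge_potential_def X by (simp add: du_def dv_def)
  have fA: "- (1 / real n) * (1 / real du + 1 / 4) \<le> attach_prob w n y * (?f y - ?c)" if y: "y \<in> ?A" for y
  proof -
    have y': "y \<in> {1..n}" "y \<noteq> u" "y \<noteq> v" "y \<notin> ?B" "y \<in> leaves w n u"
      using y sub notA disj by auto
    have a0: "a > 0" using y fin by (auto simp: a_def card_gt_0_iff)
    have "?f y \<ge> real (a + b) - 1 - real du / 4"
      unfolding edge_potential_def edge_leaves_def cA[OF y'(1)] cB[OF y'(1)] degree_upd[OF rt y'(1)]
      using y y' a0 ends by (auto simp: du_def of_nat_diff)
    then have "- (1 + real du / 4) \<le> ?f y - ?c" using c a0 by simp
    then have "1 / (real n * real du) * - (1 + real du / 4) \<le> attach_prob w n y * (?f y - ?c)"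
      unfolding attach_prob_leaf[OF rt y'(5)] du_def[symmetric] by (rule mult_left_mono) simp
    also have "1 / (real n * real du) * - (1 + real du / 4) = - (1 / real n) * (1 / real du + 1 / 4)"
      using dpos n2 by (simp add: field_simps)
    finally show ?thesis .
  qed
  have fB: "- (1 / real n) * (1 / real dv + 1 / 4) \<le> attach_prob w n y * (?f y - ?c)" if y: "y \<in> ?B" for y
  proof -
    have y': "y \<in> {1..n}" "y \<noteq> u" "y \<noteq> v" "y \<notin> ?A" "y \<in> leaves w n v"
      using y sub notB disj by auto
    have b0: "b > 0" using y fin by (auto simp: b_def card_gt_0_iff)
    have "?f y \<ge> real (a + b) - 1 - real dv / 4"
      unfolding edge_potential_def edge_leaves_def cA[OF y'(1)] cB[OF y'(1)] degree_upd[OF rt y'(1)]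
      using y y' b0 ends by (auto simp: dv_def of_nat_diff)
    then have "- (1 + real dv / 4) \<le> ?f y - ?c" using c b0 by simp
    then have "1 / (real n * real dv) * - (1 + real dv / 4) \<le> attach_prob w n y * (?f y - ?c)"
      unfolding attach_prob_leaf[OF rt y'(5)] dv_def[symmetric] by (rule mult_left_mono) simp
    also have "1 / (real n * real dv) * - (1 + real dv / 4) = - (1 / real n) * (1 / real dv + 1 / 4)"
      using dpos n2 by (simp add: field_simps)
    finally show ?thesis .
  qed
  have off: "?f y = ?c" if "y \<in> {1..n} - ({u, v} \<union> (?A \<union> ?B))" for y
  proof -
    have y: "y \<in> {1..n}" "y \<noteq> u" "y \<noteq> v" "y \<notin> ?A" "y \<notin> ?B" using that by blast+
    have "edge_leaves (w(n := y)) (Suc n) u v = edge_leaves w n u v"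
      unfolding edge_leaves_def cA[OF y(1)] cB[OF y(1)] using y by (simp add: a_def b_def)
    moreover have "deg (w(n := y)) (Suc n) u = deg w n u" "deg (w(n := y)) (Suc n) v = deg w n v"
      using y ends by (simp_all add: degree_upd[OF rt y(1)])
    ultimately show ?thesis by (simp add: edge_potential_def)
  qed
  have "(\<Sum>y\<in>{1..n}. attach_prob w n y * ?f y) - ?c =
      (\<Sum>y\<in>{u, v} \<union> (?A \<union> ?B). attach_prob w n y * (?f y - ?c))"
  proof -
    have "{u, v} \<union> (?A \<union> ?B) \<subseteq> {1..n}" using ends sub by simp
    then have "(\<Sum>y\<in>{1..n}. attach_prob w n y * ?f y) =
        ?c + (\<Sum>y\<in>{u, v} \<union> (?A \<union> ?B). attach_prob w n y * (?f y - ?c))"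
      by (rule sum_attach_prob_local[OF rt n2]) (rule off)
    then show ?thesis by linarith
  qed
  also have "\<dots> = attach_prob w n u * (?f u - ?c) + attach_prob w n v * (?f v - ?c) +
      (\<Sum>y\<in>?A. attach_prob w n y * (?f y - ?c)) + (\<Sum>y\<in>?B. attach_prob w n y * (?f y - ?c))"
  proof -
    have "{u, v} \<inter> (?A \<union> ?B) = {}" using notA notB by blast
    then show ?thesis using fin disj ends by (simp add: sum.union_disjoint del: Un_insert_left)
  qed
  also have "\<dots> \<ge> 1 / (4 * real n)"
  proof (cases "a + b = 0")
    case True
    then have e: "?A = {}" "?B = {}" using fin by (auto simp: a_def b_def)
    let ?m = "real (min du dv)"
    have m: "?m > 0" using dpos by simp
    have "1 / ?m \<le> 1 / real dv + 1 / real du" using dpos by (auto simp: min_def)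
    then have "1 / ?m / real n \<le> attach_prob w n u + attach_prob w n v"
      using pu pv True n2 divide_right_mono[of "1 / ?m" "1 / real dv + 1 / real du" "real n"]
      by (simp add: add_divide_distrib)
    then have "1 / ?m / real n * (?m / 4) \<le> (attach_prob w n u + attach_prob w n v) * (1 + ?m / 4)"
      using m n2 attach_prob_nonneg[OF rt] by (intro mult_mono add_nonneg_nonneg) auto
    then show ?thesis unfolding e fu fv c using True m by (simp add: distrib_right mult.commute)
  next
    case False
    have key: "real k / 4 \<le> real k - real k * (1 / real d + 1 / 4)" if "k < d" for k d :: nat
    proof (cases "k = 0")
      case False
      then have "1 / real d \<le> 1 / 2" using that by (intro divide_left_mono) auto
      then have "real k * (1 / real d) \<le> real k * (1 / 2)" by (intro mult_left_mono) auto
      then show ?thesis unfolding distrib_left by linarith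
    qed simp
    have "(\<Sum>y\<in>?A. attach_prob w n y * (?f y - ?c)) \<ge> real a * (- (1 / real n) * (1 / real du + 1 / 4))"
      unfolding a_def by (rule sum_bounded_below) (rule fA[unfolded a_def])
    moreover have "(\<Sum>y\<in>?B. attach_prob w n y * (?f y - ?c)) \<ge> real b * (- (1 / real n) * (1 / real dv + 1 / 4))"
      unfolding b_def by (rule sum_bounded_below) (rule fB[unfolded b_def])
    moreover have "attach_prob w n u * (?f u - ?c) \<ge> real a / real n"
    proof -
      have "real a / real n \<le> (real a + 1 / real dv) / real n" by (intro divide_right_mono) auto
      then show ?thesis unfolding fu c using False pu by auto
    qed
    moreover have "attach_prob w n v * (?f v - ?c) \<ge> real b / real n"
    proof -
      have "real b / real n \<le> (real b + 1 / real du) / real n" by (intro divide_right_mono) auto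
      then show ?thesis unfolding fv c using False pv by auto
    qed
    moreover have "1 / (4 * real n) \<le> real a / real n + real b / real n +
       real a * (- (1 / real n) * (1 / real du + 1 / 4)) + real b * (- (1 / real n) * (1 / real dv + 1 / 4))"
    proof -
      have split: "(A - A * X + (B - B * Y)) / N =
          A / N + B / N + A * (- (1 / N) * X) + B * (- (1 / N) * Y)" for A B X Y N :: real
        by (simp add: diff_divide_distrib add_divide_distrib)
      have "1 / 4 \<le> real a / 4 + real b / 4" using False by auto
      also have "\<dots> \<le> (real a - real a * (1 / real du + 1 / 4)) + (real b - real b * (1 / real dv + 1 / 4))"
        using key[OF ad] key[OF bd] by simp
      finally have "1 / 4 / real n \<le> \<dots> / real n" by (intro divide_right_mono) auto
      also have "\<dots> = real a / real n + real b / real n +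
       real a * (- (1 / real n) * (1 / real du + 1 / 4)) + real b * (- (1 / real n) * (1 / real dv + 1 / 4))"
        by (rule split)
      finally show ?thesis by simp
    qed
    ultimately show ?thesis by linarith
  qed
  finally show ?thesis by simp
qed

text \<open>
  In the Polya urn that gains a ball with probability \<open>L / n\<close>, the quantity \<open>(n - 1) / (L - 1)\<close> is a
  martingale. Here a leaf may also be lost, with probability at most \<open>1 / n\<close>; the larger shift
  \<open>L - 3\<close> leaves enough room for this as soon as \<open>1 / (L - 4) \<le> 2 / (L - 2)\<close>, that is, \<open>L \<ge> 6\<close>.
\<close>

lemma leaf_ratio_supermartingale:
  assumes rt: "recursive_tree w n" and n2: "2 \<le> n" and z: "z \<in> {1..n}"
    and L: "6 \<le> card (leaves w n z)"
  shows "(\<Sum>y\<in>{1..n}. attach_prob w n y *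
      (real (Suc n) / (real (card (leaves (w(n := y)) (Suc n) z)) - 3))) \<le>
    real n / (real (card (leaves w n z)) - 3)"
proof -
  define l where "l = real (card (leaves w n z))"
  have l6: "6 \<le> l" using L by (simp add: l_def)
  let ?f = "\<lambda>y. real (Suc n) / (real (card (leaves (w(n := y)) (Suc n) z)) - 3)"
  let ?c = "real (Suc n) / (l - 3)"
  have g: "l * (1 / (l - 2) - 1 / (l - 3)) + (1 / (l - 4) - 1 / (l - 3)) \<le> - (1 / (l - 3))"
  proof -
    have "1 / (l - 4) \<le> 2 / (l - 2)" using l6 by (simp add: field_simps)
    then have "(1 / (l - 4) - 2 / (l - 2) - 1) / (l - 3) \<le> - 1 / (l - 3)"
      using l6 by (intro divide_right_mono) auto
    moreover have "l * (1 / (l - 2) - 1 / (l - 3)) + (1 / (l - 4) - 1 / (l - 3)) =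
        (1 / (l - 4) - 2 / (l - 2) - 1) / (l - 3)"
      using l6 by (simp add: divide_simps) (simp add: algebra_simps)
    ultimately show ?thesis by simp
  qed
  have zl: "z \<notin> leaves w n z" "Suc n \<notin> leaves w n z" and sub: "leaves w n z \<subseteq> {1..n}"
    using nbrs_irrefl[OF rt] nbrs_subset[OF rt, of z] by (auto simp: leaves_def)
  have fin: "finite (leaves w n z)" using finite_leaves .
  have card: "real (card (leaves (w(n := y)) (Suc n) z)) =
      (if y = z then l + 1 else if y \<in> leaves w n z then l - 1 else l)" if "y \<in> {1..n}" for y
    unfolding leaves_upd[OF rt that n2 z] using fin zl L
    by (simp add: l_def card_Diff_singleton of_nat_diff)
  let ?S = "\<Sum>y\<in>leaves w n z. attach_prob w n y * (?f y - ?c)"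
  have "(\<Sum>y\<in>{1..n}. attach_prob w n y * ?f y) =
      ?c + (\<Sum>y\<in>insert z (leaves w n z). attach_prob w n y * (?f y - ?c))"
    using card sub z by (intro sum_attach_prob_local[OF rt n2]) auto
  also have "\<dots> = ?c + (attach_prob w n z * (?f z - ?c) + ?S)"
    using fin zl by simp
  also have "\<dots> \<le> ?c + (l / real n * (?f z - ?c) + (real (Suc n) / (l - 4) - ?c) / real n)"
  proof (intro add_left_mono add_mono)
    show "attach_prob w n z * (?f z - ?c) \<le> l / real n * (?f z - ?c)"
    proof (rule mult_right_mono_neg)
      have "(\<Sum>x\<in>leaves w n z. 1 / real (deg w n x)) / real n \<le> attach_prob w n z"
        by (rule attach_prob_ge[OF rt]) (auto simp: leaves_def)
      also have "(\<Sum>x\<in>leaves w n z. 1 / real (deg w n x)) = l" by (simp add: leaves_def l_def)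
      finally show "l / real n \<le> attach_prob w n z" .
      show "?f z - ?c \<le> 0" using card[OF z] l6 by (simp add: frac_le)
    qed
  next
    have "attach_prob w n y * (?f y - ?c) =
        1 / (real n * real (deg w n z)) * (real (Suc n) / (l - 4) - ?c)"
      if "y \<in> leaves w n z" for y
    proof -
      have "y \<noteq> z" using that zl by blast
      then have "real (card (leaves (w(n := y)) (Suc n) z)) - 3 = l - 4"
        using card[OF subsetD[OF sub that]] that by simp
      then show ?thesis by (simp only: attach_prob_leaf[OF rt that])
    qed
    then have "?S = l / real (deg w n z) * ((real (Suc n) / (l - 4) - ?c) / real n)"
      by (simp add: l_def)
    also have "\<dots> \<le> 1 * ((real (Suc n) / (l - 4) - ?c) / real n)"
    proof (rule mult_right_mono)
      show "l / real (deg w n z) \<le> 1"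
        using card_leaves_le degree_pos[OF rt n2 z] by (simp add: l_def)
      have "?c \<le> real (Suc n) / (l - 4)" using l6 by (intro divide_left_mono) auto
      then show "0 \<le> (real (Suc n) / (l - 4) - ?c) / real n" by simp
    qed
    finally show "?S \<le> (real (Suc n) / (l - 4) - ?c) / real n" by simp
  qed
  also have "\<dots> =
      ?c + real (Suc n) / real n * (l * (1 / (l - 2) - 1 / (l - 3)) + (1 / (l - 4) - 1 / (l - 3)))"
    using card[OF z] n2 by (simp add: field_simps)
  also have "\<dots> \<le> ?c + 1 * (l * (1 / (l - 2) - 1 / (l - 3)) + (1 / (l - 4) - 1 / (l - 3)))"
  proof (intro add_left_mono mult_right_mono_neg)
    have "0 \<le> 1 / (l - 3)" using l6 by simp
    then show "l * (1 / (l - 2) - 1 / (l - 3)) + (1 / (l - 4) - 1 / (l - 3)) \<le> 0"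
      using g by linarith
  qed (use n2 in simp)
  also have "\<dots> \<le> ?c + - (1 / (l - 3))"
    using g by simp
  also have "\<dots> = real n / (l - 3)" by (simp add: add_divide_distrib)
  finally show ?thesis unfolding l_def .
qed

section \<open>Almost sure growth of the leaf counts\<close>

lemma determined_before_upd:
  "determined_before n F \<Longrightarrow> n \<le> k \<Longrightarrow> F (w(k := y)) = F w"
  unfolding determined_before_def by auto

lemma determined_beforeI:
  "(\<And>w w'. (\<And>k. k \<in> {1..<n} \<Longrightarrow> w k = w' k) \<Longrightarrow> F w = F w') \<Longrightarrow> determined_before n F"
  unfolding determined_before_def by blast

lemma determined_before_mono:
  "determined_before n F \<Longrightarrow> n \<le> k \<Longrightarrow> determined_before k F"
  unfolding determined_before_def by simp

lemma edge_leaves_cong: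
  assumes "\<And>k. k \<in> {1..<n} \<Longrightarrow> w k = w' k"
  shows "edge_leaves w n u v = edge_leaves w' n u v"
proof -
  have "leaves w n z = leaves w' n z" for z using assms by (rule leaves_cong)
  then show ?thesis by (simp add: edge_leaves_def)
qed

lemma parent_edge:
  assumes "1 \<le> m" "m < n"
  shows "w m \<in> nbrs w n (Suc m)"
  unfolding mem_nbrs_iff using assms by auto

lemma edge_leaves_upd_le:
  assumes rt: "recursive_tree w n" and n2: "2 \<le> n" and uv: "v \<in> nbrs w n u" and y: "y \<in> {1..n}"
  shows "edge_leaves (w(n := y)) (Suc n) u v \<le> Suc (edge_leaves w n u v)"
proof -
  have vu: "u \<in> nbrs w n v" using uv nbrs_sym by blast
  show ?thesis
    using edge_ends(3)[OF rt n2 uv]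
    unfolding edge_leaves_def card_leaves_upd_minus[OF rt n2 uv y] card_leaves_upd_minus[OF rt n2 vu y]
    by auto
qed

context random_friend_tree
begin

text \<open>
  As long as the count stays below \<open>K\<close> the potential is at most \<open>K\<close>, yet its mean gains at least
  \<open>P / (4 * n)\<close> at step \<open>n\<close>, where \<open>P\<close> is the probability that the level is never reached. As the
  harmonic series diverges, \<open>P = 0\<close>.
\<close>

lemma AE_edge_leaves_ge:
  fixes K :: nat
  assumes m: "1 \<le> m"
  shows "AE \<omega> in M. \<exists>k\<ge>Suc m. K \<le> edge_leaves (\<lambda>i. W i \<omega>) k (Suc m) (W m \<omega>)"
proof -
  define alive where
    "alive n w \<longleftrightarrow> (\<forall>k\<in>{Suc m..n}. edge_leaves w k (Suc m) (w m) < K)" for n and w :: "nat \<Rightarrow> nat"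
  \<comment> \<open>The potential stopped on reaching level \<open>K\<close>; by then it is at most \<open>K\<close>, so freezing it at \<open>K\<close> keeps the drift.\<close>
  define F where
    "F n w = (if alive n w then edge_potential w n (Suc m) (w m) else real K)" for n w
  have det: "determined_before n (alive n)" if "Suc m \<le> n" for n
  proof (rule determined_beforeI)
    fix w w' :: "nat \<Rightarrow> nat" assume eq: "\<And>k. k \<in> {1..<n} \<Longrightarrow> w k = w' k"
    have "w m = w' m" using eq[of m] that m by simp
    moreover have "edge_leaves w k u v = edge_leaves w' k u v" if "k \<le> n" for k u v
      using eq that by (intro edge_leaves_cong) auto
    ultimately show "alive n w = alive n w'" unfolding alive_def by simp
  qed
  have step: "F n w + of_bool (alive n w) / (4 * real n) \<le>
      (\<Sum>y\<in>{1..n}. attach_prob w n y * F (Suc n) (w(n := y)))"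
    if n: "Suc m \<le> n" and rt: "recursive_tree w n" for n w
  proof -
    have n2: "2 \<le> n" using n m by simp
    have mn: "(w(n := y)) m = w m" for y using n by simp
    have al: "alive (Suc n) (w(n := y)) \<longleftrightarrow>
        alive n w \<and> edge_leaves (w(n := y)) (Suc n) (Suc m) (w m) < K" for y
    proof -
      have "{Suc m..Suc n} = insert (Suc n) {Suc m..n}" using n by auto
      then show ?thesis
        using determined_before_upd[OF det[OF n] order.refl, of w y] mn[of y]
        unfolding alive_def by auto
    qed
    show ?thesis
    proof (cases "alive n w")
      case False
      then show ?thesis
        using sum_attach_prob[OF rt n2] by (simp add: F_def al flip: sum_distrib_right)
    next
      case True
      have uv: "w m \<in> nbrs w n (Suc m)" using parent_edge m n by simp
      have "edge_potential (w(n := y)) (Suc n) (Suc m) (w m) \<le> F (Suc n) (w(n := y))"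
        if y: "y \<in> {1..n}" for y
      proof (cases "alive (Suc n) (w(n := y))")
        case False
        have "edge_leaves w n (Suc m) (w m) < K" using True n by (simp add: alive_def)
        then have "edge_leaves (w(n := y)) (Suc n) (Suc m) (w m) \<le> K"
          using edge_leaves_upd_le[OF rt n2 uv y] by linarith
        moreover have "edge_potential (w(n := y)) (Suc n) (Suc m) (w m) \<le>
            real (edge_leaves (w(n := y)) (Suc n) (Suc m) (w m))"
          by (simp add: edge_potential_def)
        ultimately show ?thesis using False by (simp add: F_def)
      qed (use n in \<open>simp add: F_def\<close>)
      then have "(\<Sum>y\<in>{1..n}. attach_prob w n y * edge_potential (w(n := y)) (Suc n) (Suc m) (w m)) \<le>
          (\<Sum>y\<in>{1..n}. attach_prob w n y * F (Suc n) (w(n := y)))"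
        using attach_prob_nonneg[OF rt] by (intro sum_mono mult_left_mono) auto
      then show ?thesis
        using edge_potential_drift[OF rt n2 uv] True by (simp add: F_def)
    qed
  qed
  let ?never = "{\<omega> \<in> space M. \<forall>k\<ge>Suc m. edge_leaves (\<lambda>i. W i \<omega>) k (Suc m) (W m \<omega>) < K}"
  let ?p = "prob ?never"
  have alive_event: "{\<omega> \<in> space M. alive n (\<lambda>i. W i \<omega>)} \<in> events" if "Suc m \<le> n" for n
    using determined_event[OF det[OF that]] by (simp add: pred_def)
  have p_le: "?p \<le> mean n (\<lambda>w. of_bool (alive n w))" if n: "Suc m \<le> n" for n
  proof -
    have "?p \<le> \<P>(\<omega> in M. alive n (\<lambda>i. W i \<omega>))"
      by (rule finite_measure_mono[OF _ alive_event[OF n]]) (auto simp: alive_def)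
    also have "\<dots> = mean n (\<lambda>w. of_bool (alive n w))"
      using prob_eq_mean[OF _ det[OF n]] n m by simp
    finally show ?thesis .
  qed
  have grow: "mean (Suc m) (F (Suc m)) + (\<Sum>i<j. ?p / (4 * real (Suc m + i))) \<le>
      mean (Suc m + j) (F (Suc m + j))" for j
  proof (induction j)
    case (Suc j)
    let ?n = "Suc m + j"
    have "mean ?n (F ?n) + ?p / (4 * real ?n) \<le>
        mean ?n (F ?n) + 1 / (4 * real ?n) * mean ?n (\<lambda>w. of_bool (alive ?n w))"
      using p_le[of ?n] by (simp add: divide_right_mono)
    also have "\<dots> = mean ?n (\<lambda>w. F ?n w + 1 / (4 * real ?n) * of_bool (alive ?n w))"
      by (simp only: mean_add mean_cmult)
    also have "\<dots> \<le> mean ?n (\<lambda>w. \<Sum>y\<in>{1..?n}. attach_prob w ?n y * F (Suc ?n) (w(?n := y)))"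
      using step[of ?n] by (intro mean_mono) simp
    also have "\<dots> = mean (Suc ?n) (F (Suc ?n))"
      using m by (intro mean_Suc[symmetric]) simp
    finally show ?case using Suc by simp
  qed simp
  have "F n w \<le> real K" if "Suc m \<le> n" for n w
    using that by (force simp: F_def alive_def edge_potential_def)
  then have mean_le: "mean n (F n) \<le> real K" if "Suc m \<le> n" for n
    using mean_mono[of n "F n" "\<lambda>_. real K"] mean_const[of n "real K"] that m by simp
  then have bd: "(\<Sum>i<j. ?p / (4 * real (Suc m + i))) \<le> real K - mean (Suc m) (F (Suc m))" for j
    using order.trans[OF grow[of j] mean_le[OF le_add1]] by linarith
  have "?p = 0"
  proof (rule ccontr)
    assume "?p \<noteq> 0"
    then have p: "?p > 0" by (simp add: zero_less_measure_iff)
    have "summable (\<lambda>i. ?p / (4 * real (Suc m + i)))"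
      using bd p by (intro summableI_nonneg_bounded[of _ "real K - mean (Suc m) (F (Suc m))"]) auto
    then have "summable (\<lambda>i. (4 / ?p) * (?p / (4 * real (Suc m + i))))"
      by (rule summable_mult)
    moreover have "4 / ?p * (?p / (4 * x)) = inverse x" for x :: real
      using p by (simp add: inverse_eq_divide)
    ultimately have "summable (\<lambda>i. inverse (real (i + Suc m)))"
      by (simp only: add.commute)
    then have "summable (\<lambda>i. inverse (real i))"
      by (subst (asm) summable_iff_shift)
    then show False using not_summable_harmonic[where 'a = real] by simp
  qed
  moreover have "?never \<in> events"
  proof -
    have "?never = (\<Inter>n\<in>{Suc m..}. {\<omega> \<in> space M. alive n (\<lambda>i. W i \<omega>)})"
      by (auto simp: alive_def)
    then show ?thesis using alive_event by (auto intro!: sets.countable_INT')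
  qed
  ultimately have "AE \<omega> in M. \<omega> \<notin> ?never"
    using prob_eq_0 by blast
  then show ?thesis by (rule AE_mp) (auto simp: not_less)
qed

text \<open>
  The maximal inequality for the supermartingale \<open>k / (L - 3)\<close>, where \<open>L\<close> is the number of leaf
  neighbours of \<open>z\<close> at time \<open>k\<close>, started at time \<open>s\<close> on the event \<open>A\<close>. It starts at no more than
  \<open>s / (K - 3)\<close> and is at least \<open>s / 2\<close> at the first \<open>k\<close> with \<open>L \<le> 3 + 2 * k / s\<close>. Before that
  time \<open>L > 5\<close>, as \<open>leaf_ratio_supermartingale\<close> requires, so that the bound covers both the loss of
  linear growth and the exit from this range. The vertex \<open>z\<close> may depend on the tree at time
  \<open>s\<close>, because the endpoint that is observed later is selected then.
\<close>

lemma prob_leaf_count_fails_linear_le: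
  fixes K s :: nat
  assumes s: "2 \<le> s" and K: "6 \<le> K"
    and A: "determined_before s A" and z: "determined_before s z"
    and start: "\<And>w. recursive_tree w s \<Longrightarrow> A w \<Longrightarrow> z w \<in> {1..s} \<and> K \<le> card (leaves w s (z w))"
  shows "\<P>(\<omega> in M. A (\<lambda>i. W i \<omega>) \<and> (\<exists>k\<ge>s.
      real (card (leaves (\<lambda>i. W i \<omega>) k (z (\<lambda>i. W i \<omega>)))) \<le> 3 + 2 * real k / real s)) \<le>
    2 / (real K - 3) * \<P>(\<omega> in M. A (\<lambda>i. W i \<omega>))"
    (is "?p \<le> _")
    and "{\<omega> \<in> space M. A (\<lambda>i. W i \<omega>) \<and> (\<exists>k\<ge>s.
      real (card (leaves (\<lambda>i. W i \<omega>) k (z (\<lambda>i. W i \<omega>)))) \<le> 3 + 2 * real k / real s)} \<in> events"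
    (is "?E \<in> _")
proof -
  define l where "l k w = real (card (leaves w k (z w)))" for k w
  define alive where
    "alive n w \<longleftrightarrow> (\<forall>k\<in>{s..n}. 3 + 2 * real k / real s < l k w)" for n w
  \<comment> \<open>The supermartingale on \<open>A\<close>, replaced at the first failure by the lower bound \<open>s / 2\<close> that it satisfies there.\<close>
  define F where
    "F n w = of_bool (A w) * (if alive n w then real n / (l n w - 3) else real s / 2)" for n w
  have det_l: "determined_before n (l k)" if "s \<le> n" "k \<le> n" for n k
  proof (rule determined_beforeI)
    fix w w' :: "nat \<Rightarrow> nat" assume eq: "\<And>k. k \<in> {1..<n} \<Longrightarrow> w k = w' k"
    have "z w = z w'" using z eq that unfolding determined_before_def by auto
    moreover have "leaves w k x = leaves w' k x" for x
      using eq that by (intro leaves_cong) auto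
    ultimately show "l k w = l k w'" by (simp add: l_def)
  qed
  have det: "determined_before n (alive n)" if "s \<le> n" for n
    using det_l[OF that] unfolding determined_before_def alive_def by (metis atLeastAtMost_iff)
  have det_A: "determined_before n A" if "s \<le> n" for n
    using determined_before_mono[OF A that] .
  have step: "(\<Sum>y\<in>{1..n}. attach_prob w n y * F (Suc n) (w(n := y))) \<le> F n w"
    if n: "s \<le> n" and rt: "recursive_tree w n" for n w
  proof -
    have n2: "2 \<le> n" using n s by simp
    have Aw: "A (w(n := y)) = A w" for y using determined_before_upd[OF A n] .
    have zw: "z (w(n := y)) = z w" for y using determined_before_upd[OF z n] .
    have al: "alive (Suc n) (w(n := y)) \<longleftrightarrow>
        alive n w \<and> 3 + 2 * real (Suc n) / real s < l (Suc n) (w(n := y))" for y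
    proof -
      have "{s..Suc n} = insert (Suc n) {s..n}" using n by auto
      then show ?thesis
        using determined_before_upd[OF det[OF n] order.refl, of w y] unfolding alive_def by auto
    qed
    show ?thesis
    proof (cases "A w \<and> alive n w")
      case False
      then have "F (Suc n) (w(n := y)) = F n w" for y by (auto simp: F_def al Aw)
      then show ?thesis using sum_attach_prob[OF rt n2] by (simp flip: sum_distrib_right)
    next
      case True
      have rts: "recursive_tree w s" using rt n by (auto simp: recursive_tree_def)
      have zs: "z w \<in> {1..n}" using start[OF rts] True n by auto
      have "2 * 1 \<le> 2 * (real n / real s)" using n s by (intro mult_left_mono) auto
      moreover have "3 + 2 * real n / real s < l n w" using True n by (simp add: alive_def)
      ultimately have "5 < l n w" by simp
      then have L: "6 \<le> card (leaves w n (z w))" by (simp add: l_def)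
      have "F (Suc n) (w(n := y)) \<le> real (Suc n) / (real (card (leaves (w(n := y)) (Suc n) (z w))) - 3)"
        if y: "y \<in> {1..n}" for y
      proof (cases "alive (Suc n) (w(n := y))")
        case False
        have "card (leaves w n (z w)) - 1 \<le> card (leaves (w(n := y)) (Suc n) (z w))"
          unfolding leaves_upd[OF rt y n2 zs]
          by (auto simp: card_Diff_singleton_if card_insert_if)
        then have g: "2 \<le> l (Suc n) (w(n := y)) - 3" using L by (simp add: l_def zw)
        have "l (Suc n) (w(n := y)) - 3 \<le> 2 * real (Suc n) / real s"
          using False True by (simp add: al)
        then have "real s / 2 \<le> real (Suc n) / (l (Suc n) (w(n := y)) - 3)"
          using g s by (simp add: field_simps)
        then show ?thesis using False True by (simp add: F_def Aw l_def zw)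
      qed (use True in \<open>simp add: F_def Aw l_def zw\<close>)
      then have "(\<Sum>y\<in>{1..n}. attach_prob w n y * F (Suc n) (w(n := y))) \<le>
          (\<Sum>y\<in>{1..n}. attach_prob w n y *
            (real (Suc n) / (real (card (leaves (w(n := y)) (Suc n) (z w))) - 3)))"
        using attach_prob_nonneg[OF rt] by (intro sum_mono mult_left_mono) auto
      also have "\<dots> \<le> real n / (l n w - 3)"
        using leaf_ratio_supermartingale[OF rt n2 zs L] by (simp add: l_def)
      also have "\<dots> = F n w" using True by (simp add: F_def)
      finally show ?thesis .
    qed
  qed
  have decrease: "mean (s + j) (F (s + j)) \<le> mean s (F s)" for j
  proof (induction j)
    case (Suc j)
    have "mean (Suc (s + j)) (F (Suc (s + j))) =
        mean (s + j) (\<lambda>w. \<Sum>y\<in>{1..s + j}. attach_prob w (s + j) y * F (Suc (s + j)) (w((s + j) := y)))"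
      using s by (intro mean_Suc) simp
    also have "\<dots> \<le> mean (s + j) (F (s + j))"
      using step[of "s + j"] by (intro mean_mono) simp
    finally show ?case using Suc by simp
  qed simp
  have init: "mean s (F s) \<le> real s / (real K - 3) * \<P>(\<omega> in M. A (\<lambda>i. W i \<omega>))"
  proof -
    have "F s w \<le> real s / (real K - 3) * of_bool (A w)" if rt: "recursive_tree w s" for w
    proof (cases "A w")
      case True
      then have "real K \<le> l s w" using start[OF rt] by (simp add: l_def)
      moreover from this have "alive s w" using s K by (simp add: alive_def)
      ultimately show ?thesis using True K by (simp add: F_def divide_left_mono)
    qed (simp add: F_def)
    then have "mean s (F s) \<le> mean s (\<lambda>w. real s / (real K - 3) * of_bool (A w))"
      by (rule mean_mono)
    then show ?thesis by (simp only: mean_cmult prob_eq_mean[OF s A])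
  qed
  let ?B = "\<lambda>j. {\<omega> \<in> space M. A (\<lambda>i. W i \<omega>) \<and> \<not> alive (s + j) (\<lambda>i. W i \<omega>)}"
  have det_B: "determined_before (s + j) (\<lambda>w. A w \<and> \<not> alive (s + j) w)" for j
    using det[of "s + j"] det_A[of "s + j"] unfolding determined_before_def by (metis le_add1)
  have B_event: "?B j \<in> events" for j
    using determined_event[OF det_B[of j]] by (simp add: pred_def)
  have B_le: "prob (?B j) \<le> 2 / (real K - 3) * \<P>(\<omega> in M. A (\<lambda>i. W i \<omega>))" for j
  proof -
    have pos: "0 \<le> F (s + j) w - real s / 2 * of_bool (A w \<and> \<not> alive (s + j) w)" for w
    proof (cases "alive (s + j) w")
      case True
      then have "3 + 2 * real (s + j) / real s < l (s + j) w"
        unfolding alive_def by (rule bspec) simp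
      then have "3 \<le> l (s + j) w" using divide_nonneg_nonneg[of "2 * real (s + j)" "real s"] by linarith
      then show ?thesis using True by (simp add: F_def)
    qed (simp add: F_def)
    have "real s / 2 * prob (?B j) = mean (s + j) (\<lambda>w. real s / 2 * of_bool (A w \<and> \<not> alive (s + j) w))"
      using prob_eq_mean[OF _ det_B[of j]] s by (simp only: mean_cmult)
    also have "\<dots> \<le> mean (s + j) (F (s + j))"
      using pos by (intro mean_mono) (simp add: algebra_simps)
    also have "\<dots> \<le> real s / (real K - 3) * \<P>(\<omega> in M. A (\<lambda>i. W i \<omega>))"
      using decrease[of j] init by linarith
    also have "\<dots> = real s / 2 * (2 / (real K - 3) * \<P>(\<omega> in M. A (\<lambda>i. W i \<omega>)))" by simp
    finally show ?thesis by (rule mult_left_le_imp_le) (use s in simp)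
  qed
  have E: "?E = (\<Union>j. ?B j)"
  proof (intro equalityI subsetI)
    fix \<omega> assume "\<omega> \<in> ?E"
    then obtain k where k: "s \<le> k" "\<omega> \<in> space M" "A (\<lambda>i. W i \<omega>)"
      "l k (\<lambda>i. W i \<omega>) \<le> 3 + 2 * real k / real s" by (auto simp: l_def)
    then have "\<omega> \<in> ?B (k - s)" by (auto simp: alive_def not_less)
    then show "\<omega> \<in> (\<Union>j. ?B j)" by blast
  qed (auto simp: alive_def l_def not_less)
  show "?E \<in> events" unfolding E using B_event by blast
  have "(\<lambda>j. prob (?B j)) \<longlonglongrightarrow> prob (\<Union>j. ?B j)"
  proof (rule finite_Lim_measure_incseq)
    show "incseq ?B" by (intro incseq_SucI) (auto simp: alive_def)
  qed (use B_event in blast)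
  then show "?p \<le> 2 / (real K - 3) * \<P>(\<omega> in M. A (\<lambda>i. W i \<omega>))"
    unfolding E using B_le by (intro LIMSEQ_le_const2) auto
qed

text \<open>
  Let \<open>k\<close> be the first time at which \<open>2 * K\<close> leaves hang from the edge; it is almost surely finite.
  Some endpoint then has \<open>K\<close> leaf neighbours, and it fails to grow linearly with conditional
  probability at most \<open>2 / (K - 3)\<close>. Summing over the disjoint events \<open>first K k\<close> bounds the
  probability of failure by \<open>2 / (K - 3)\<close>. Waiting for many leaves makes this arbitrarily small.
\<close>

lemma AE_leaf_count_linear:
  assumes m: "1 \<le> m"
  shows "AE \<omega> in M. \<exists>z\<in>{Suc m, W m \<omega>}. \<exists>s\<ge>2. \<forall>k\<ge>s.
    3 + 2 * real k / real s < real (card (leaves (\<lambda>i. W i \<omega>) k z))"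
proof -
  define big where "big K k w \<longleftrightarrow> 2 * K \<le> edge_leaves w k (Suc m) (w m)" for K k and w :: "nat \<Rightarrow> nat"
  define first where "first K k w \<longleftrightarrow> big K k w \<and> (\<forall>j\<in>{Suc m..<k}. \<not> big K j w)" for K k w
  \<comment> \<open>An endpoint of the edge with at least half of the \<open>2 * K\<close> leaves, selected by the tree at time \<open>k\<close>.\<close>
  define z where "z K k w = (if K \<le> card (leaves w k (Suc m)) then Suc m else w m)" for K k w
  have det_big: "determined_before n (big K k)" if "m < n" "k \<le> n" for K k n
  proof (rule determined_beforeI)
    fix w w' :: "nat \<Rightarrow> nat" assume eq: "\<And>k. k \<in> {1..<n} \<Longrightarrow> w k = w' k"
    have "w m = w' m" using eq[of m] that m by simp
    moreover have "edge_leaves w k u v = edge_leaves w' k u v" for u v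
      using eq that by (intro edge_leaves_cong) auto
    ultimately show "big K k w = big K k w'" by (simp add: big_def)
  qed
  have det_first: "determined_before k (first K k)" if "m < k" for K k
    using det_big[OF that] unfolding determined_before_def first_def
    by (metis atLeastLessThan_iff less_imp_le order.refl)
  have det_z: "determined_before k (z K k)" if "m < k" for K k
  proof (rule determined_beforeI)
    fix w w' :: "nat \<Rightarrow> nat" assume eq: "\<And>j. j \<in> {1..<k} \<Longrightarrow> w j = w' j"
    have "w m = w' m" using eq[of m] that m by simp
    moreover have "leaves w k u = leaves w' k u" for u
      using eq by (rule leaves_cong)
    ultimately show "z K k w = z K k w'" by (simp add: z_def)
  qed
  have start: "z K k w \<in> {1..k} \<and> K \<le> card (leaves w k (z K k w))"
    if k: "m < k" and rt: "recursive_tree w k" and big: "first K k w" for K k w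
  proof -
    have "card (leaves w k (Suc m) - {w m}) \<le> card (leaves w k (Suc m))"
      "card (leaves w k (w m) - {Suc m}) \<le> card (leaves w k (w m))"
      by (auto intro: card_mono)
    then have "K \<le> card (leaves w k (Suc m)) \<or> K \<le> card (leaves w k (w m))"
      using big unfolding first_def big_def edge_leaves_def by linarith
    moreover have "w m \<in> {1..m}" using rt k m by (auto simp: recursive_tree_def)
    ultimately show ?thesis using k m by (auto simp: z_def)
  qed
  let ?fail = "\<lambda>K k \<omega>. \<exists>j\<ge>k.
      real (card (leaves (\<lambda>i. W i \<omega>) j (z K k (\<lambda>i. W i \<omega>)))) \<le> 3 + 2 * real j / real k"
  let ?A = "\<lambda>K i. {\<omega> \<in> space M. first K (i + Suc m) (\<lambda>i. W i \<omega>)}"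
  let ?B = "\<lambda>K i. {\<omega> \<in> space M. first K (i + Suc m) (\<lambda>i. W i \<omega>) \<and> ?fail K (i + Suc m) \<omega>}"
  let ?C = "\<lambda>K. \<Union>i. ?B K i"
  have A_event: "?A K i \<in> events" for K i
    using determined_event[OF det_first[of "i + Suc m"]] by (simp add: pred_def)
  have B_event: "?B K i \<in> events" and B_le: "prob (?B K i) \<le> 2 / (real K - 3) * prob (?A K i)"
    if K: "6 \<le> K" for K i
    using prob_leaf_count_fails_linear_le[of "i + Suc m" K "first K (i + Suc m)" "z K (i + Suc m)"]
      m K det_first det_z start by auto
  have disj: "disjoint_family (?A K)" for K
  proof -
    have "i = j" if "first K (i + Suc m) w" "first K (j + Suc m) w" for i j w
    proof (rule ccontr)
      assume "i \<noteq> j"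
      then have "i + Suc m \<in> {Suc m..<j + Suc m} \<or> j + Suc m \<in> {Suc m..<i + Suc m}" by auto
      then show False using that unfolding first_def by blast
    qed
    then show ?thesis by (auto simp: disjoint_family_on_def)
  qed
  have C_event: "?C K \<in> events" if "6 \<le> K" for K
    using B_event[OF that] by blast
  have C_le: "prob (?C K) \<le> 2 / (real K - 3)" if K: "6 \<le> K" for K
  proof -
    have "disjoint_family (?B K)" using disj[of K] by (fastforce simp: disjoint_family_on_def)
    then have B: "(\<lambda>i. prob (?B K i)) sums prob (?C K)"
      using B_event[OF K] by (intro finite_measure_UNION) auto
    have "(\<lambda>i. prob (?A K i)) sums prob (\<Union>i. ?A K i)"
      using A_event disj by (intro finite_measure_UNION) auto
    then have "(\<lambda>i. 2 / (real K - 3) * prob (?A K i)) sums (2 / (real K - 3) * prob (\<Union>i. ?A K i))"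
      by (rule sums_mult)
    then have "prob (?C K) \<le> 2 / (real K - 3) * prob (\<Union>i. ?A K i)"
      by (rule sums_le[OF B_le[OF K] B])
    also have "\<dots> \<le> 2 / (real K - 3) * 1"
      using K by (intro mult_left_mono) auto
    finally show ?thesis by simp
  qed
  let ?N = "\<Inter>K\<in>{6..}. ?C K"
  have N_event: "?N \<in> events"
    using C_event by (intro sets.countable_INT') auto
  have "prob ?N = 0"
  proof (rule ccontr)
    assume "prob ?N \<noteq> 0"
    then have p: "prob ?N > 0" by (simp add: zero_less_measure_iff)
    obtain K :: nat where K: "6 + 2 / prob ?N < real K" using reals_Archimedean2 by blast
    then have K6: "6 \<le> K" using p divide_pos_pos[of 2 "prob ?N"] by linarith
    have "prob ?N \<le> prob (?C K)"
      using K6 C_event[OF K6] by (intro finite_measure_mono) auto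
    also have "\<dots> \<le> 2 / (real K - 3)" using C_le[OF K6] .
    finally have "prob ?N * (real K - 3) \<le> 2" using K6 by (simp add: field_simps)
    moreover have "2 / prob ?N < real K - 3" using K by simp
    then have "2 < prob ?N * (real K - 3)" using p by (simp add: field_simps)
    ultimately show False by simp
  qed
  then have "AE \<omega> in M. \<omega> \<notin> ?N" using prob_eq_0[OF N_event] by simp
  moreover have "AE \<omega> in M. \<forall>K. \<exists>k\<ge>Suc m. big K k (\<lambda>i. W i \<omega>)"
    unfolding AE_all_countable big_def using AE_edge_leaves_ge[OF m] by blast
  ultimately show ?thesis
  proof (rule AE_mp[OF _ AE_mp], intro AE_I2 impI)
    fix \<omega> assume \<omega>: "\<omega> \<in> space M" and hits: "\<forall>K. \<exists>k\<ge>Suc m. big K k (\<lambda>i. W i \<omega>)" and "\<omega> \<notin> ?N"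
    then obtain K where K: "6 \<le> K" "\<omega> \<notin> ?C K" by auto
    define k where "k = (LEAST k. Suc m \<le> k \<and> big K k (\<lambda>i. W i \<omega>))"
    have k: "Suc m \<le> k" "big K k (\<lambda>i. W i \<omega>)"
      using LeastI_ex[of "\<lambda>k. Suc m \<le> k \<and> big K k (\<lambda>i. W i \<omega>)"] hits by (auto simp: k_def)
    have "\<not> big K j (\<lambda>i. W i \<omega>)" if "j \<in> {Suc m..<k}" for j
      using not_less_Least[of j "\<lambda>k. Suc m \<le> k \<and> big K k (\<lambda>i. W i \<omega>)"] that by (auto simp: k_def)
    then have "first K k (\<lambda>i. W i \<omega>)" using k by (simp add: first_def)
    moreover have "\<omega> \<notin> ?B K (k - Suc m)" using K by blast
    ultimately have "\<not> ?fail K k \<omega>" using k \<omega> by simp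
    then have "\<forall>j\<ge>k. 3 + 2 * real j / real k <
        real (card (leaves (\<lambda>i. W i \<omega>) j (z K k (\<lambda>i. W i \<omega>))))"
      by (meson linorder_not_le)
    moreover have "z K k (\<lambda>i. W i \<omega>) \<in> {Suc m, W m \<omega>}" by (simp add: z_def)
    moreover have "2 \<le> k" using k m by simp
    ultimately show "\<exists>z\<in>{Suc m, W m \<omega>}. \<exists>s\<ge>2. \<forall>k\<ge>s.
        3 + 2 * real k / real s < real (card (leaves (\<lambda>i. W i \<omega>) k z))" by blast
  qed
qed

end

section \<open>Positivity of the limit inferior\<close>

lemma Z_nonneg: "0 \<le> Z W v \<omega>"
  unfolding Z_def by (intro Liminf_bounded) simp

lemma Z_ge_of_linear_leaf_count:
  assumes s: "2 \<le> s"
    and l: "\<And>k. s \<le> k \<Longrightarrow> 3 + 2 * real k / real s < real (card (leaves (\<lambda>i. W i \<omega>) k v))"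
  shows "ereal (2 / real s) \<le> Z W v \<omega>"
  unfolding Z_def
proof (intro Liminf_bounded eventually_sequentiallyI[of s])
  fix k assume k: "s \<le> k"
  have "2 * real k / real s \<le> real (D W k v \<omega>)"
    using l[OF k] card_leaves_le[of "\<lambda>i. W i \<omega>" k v] unfolding D_def by linarith
  then have "2 * real k / real s / real k \<le> real (D W k v \<omega>) / real k"
    by (intro divide_right_mono) auto
  then show "ereal (2 / real s) \<le> ereal (real (D W k v \<omega>) / real k)"
    using k s by simp
qed

theorem theorem3p2:
  fixes M :: "'a measure" and V W :: "nat \<Rightarrow> 'a \<Rightarrow> nat" and m :: nat
  assumes "random_friend_tree M V W"
    and "m \<ge> 1"
  shows "AE \<omega> in M. Z W (m + 1) \<omega> + Z W (W m \<omega>) \<omega> > 0"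
proof -
  interpret random_friend_tree M V W by fact
  show ?thesis
  proof (rule AE_mp[OF AE_leaf_count_linear[OF assms(2)]], intro AE_I2 impI)
    fix \<omega>
    assume "\<exists>z\<in>{Suc m, W m \<omega>}. \<exists>s\<ge>2. \<forall>k\<ge>s.
      3 + 2 * real k / real s < real (card (leaves (\<lambda>i. W i \<omega>) k z))"
    then obtain z s where z: "z \<in> {Suc m, W m \<omega>}" and s: "2 \<le> s" and
      l: "\<And>k. s \<le> k \<Longrightarrow> 3 + 2 * real k / real s < real (card (leaves (\<lambda>i. W i \<omega>) k z))"
      by blast
    have "0 < ereal (2 / real s)" using s by simp
    also have "\<dots> \<le> Z W z \<omega>" by (rule Z_ge_of_linear_leaf_count[OF s]) (rule l)
    also have "\<dots> \<le> Z W (m + 1) \<omega> + Z W (W m \<omega>) \<omega>"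
      using z add_mono[OF order.refl Z_nonneg[of W "W m \<omega>" \<omega>], of "Z W (m + 1) \<omega>"]
        add_mono[OF Z_nonneg[of W "m + 1" \<omega>] order.refl, of "Z W (W m \<omega>) \<omega>"] by auto
    finally show "Z W (m + 1) \<omega> + Z W (W m \<omega>) \<omega> > 0" .
  qed
qed

end
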